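(* Let $|\Omega_1|,\dots,|\Omega_m|>0$, $\alpha\in\mathbb R$, $\mathbf b\in\mathbb R^m$, and let $\mathbf A=(a_{i,j})\in\mathbb R^{m\times m}$ satisfy $\sum_{i=1}^m|\Omega_i|(\mathbf A\mathbf y)_i=0$ for all $\mathbf y\in\mathbb R^m$. Write $\mathbf A=\mathbf D+\mathbf L+\mathbf U$ with $\mathbf D,\mathbf L,\mathbf U$ the diagonal, strictly lower and strictly upper triangular parts, and assume $\mathbf I-\alpha(\mathbf D+\mathbf L)$ is invertible. The iterates of the Gauss–Seidel method $$\mathbf u^{(k+1)}=\alpha(\mathbf I-\alpha(\mathbf D+\mathbf L))^{-1}\mathbf U\mathbf u^{(k)}+(\mathbf I-\alpha(\mathbf D+\mathbf L))^{-1}\mathbf b$$ for $(\mathbf I-\alpha\mathbf A)\mathbf u=\mathbf b$ have a conservation error $\sum_{i}|\Omega_i|u_i^{(k+1)}-\sum_{i}|\Omega_i|b_i$ given by $$-\alpha\sum_{i=1}^m|\Omega_i|\sum_{j=i+1}^m a_{i,j}\left(u_j^{(k+1)}-u_j^{(k)}\right).$$ The Gauss–Seidel method is not globally conservative in general: there exist such $m$, $|\Omega_i|$, $\alpha$, $\mathbf A$, $\mathbf b$ and an initial guess $\mathbf u^{(0)}$ with $\sum_i|\Omega_i|u_i^{(0)}=\sum_i|\Omega_i|b_i$ for which $\sum_i|\Omega_i|u_i^{(1)}\ne\sum_i|\Omega_i|b_i$. However, if $\mathbf A$ is lower triangular, then $\sum_i|\Omega_i|u_i^{(k+1)}=\sum_i|\Omega_i|b_i$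 for all $k\ge0$.
   Context: The mass of a vector $\mathbf y\in\mathbb R^m$ is $\sum_{i=1}^m|\Omega_i|y_i$, where $|\Omega_i|$ is the volume of the $i$th cell. An iterative method for $(\mathbf I-\alpha\mathbf A)\mathbf u=\mathbf b$ is globally conservative if all iterates $\mathbf u^{(k+1)}$, $k\ge0$, have the same mass as $\mathbf b$, when the initial guess $\mathbf u^{(0)}$ has the mass of $\mathbf b$. *)

theory Defs
  imports "Jordan_Normal_Form.Gauss_Jordan_Elimination"
begin

(* Vectors in R^m and m x m matrices are elements of carrier_vec m and carrier_mat m m,
   indexed from 0, so that the index range 1..m becomes 0..m-1. The vector w collects the
   cell volumes. *)

definition mass :: "real vec \<Rightarrow> real vec \<Rightarrow> real" where
  "mass w y = (\<Sum>i<dim_vec y. w $ i * y $ i)"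

definition diag_part :: "real mat \<Rightarrow> real mat" where
  "diag_part A = mat (dim_row A) (dim_col A) (\<lambda>(i, j). if i = j then A $$ (i, j) else 0)"

definition strict_lower_part :: "real mat \<Rightarrow> real mat" where
  "strict_lower_part A = mat (dim_row A) (dim_col A) (\<lambda>(i, j). if j < i then A $$ (i, j) else 0)"

definition strict_upper_part :: "real mat \<Rightarrow> real mat" where
  "strict_upper_part A = mat (dim_row A) (dim_col A) (\<lambda>(i, j). if i < j then A $$ (i, j) else 0)"

lemma diag_lower_upper_decomposition:
  "A = diag_part A + strict_lower_part A + strict_upper_part A"
  by (rule eq_matI) (auto simp: diag_part_def strict_lower_part_def strict_upper_part_def)

definition lower_triangular :: "real mat \<Rightarrow> bool" where
  "lower_triangular A \<longleftrightarrow> (\<forall>i<dim_row A. \<forall>j<dim_col A. i < j \<longrightarrow> A $$ (i, j) = 0)"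

definition gs_matrix :: "real \<Rightarrow> real mat \<Rightarrow> real mat" where
  "gs_matrix \<alpha> A = 1\<^sub>m (dim_row A) - \<alpha> \<cdot>\<^sub>m (diag_part A + strict_lower_part A)"

(* mat_inverse returns an option; the value of "the" is only meaningful for an invertible
   argument, which is assumed wherever the iteration is used. *)
primrec gauss_seidel :: "real \<Rightarrow> real mat \<Rightarrow> real vec \<Rightarrow> real vec \<Rightarrow> nat \<Rightarrow> real vec" where
  "gauss_seidel \<alpha> A b u0 0 = u0"
| "gauss_seidel \<alpha> A b u0 (Suc k) =
     (\<alpha> \<cdot>\<^sub>m (the (mat_inverse (gs_matrix \<alpha> A)) * strict_upper_part A)) *\<^sub>v gauss_seidel \<alpha> A b u0 k
       + the (mat_inverse (gs_matrix \<alpha> A)) *\<^sub>v b"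

(* An iterative method with right-hand side b is represented by the map that sends an
   initial guess to its sequence of iterates. *)
definition globally_conservative ::
  "real vec \<Rightarrow> real vec \<Rightarrow> (real vec \<Rightarrow> nat \<Rightarrow> real vec) \<Rightarrow> bool" where
  "globally_conservative w b iter \<longleftrightarrow>
     (\<forall>u0 \<in> carrier_vec (dim_vec b).
        mass w u0 = mass w b \<longrightarrow> (\<forall>k. mass w (iter u0 (Suc k)) = mass w b))"

definition gs_setting :: "nat \<Rightarrow> real vec \<Rightarrow> real \<Rightarrow> real mat \<Rightarrow> real vec \<Rightarrow> bool" where
  "gs_setting m w \<alpha> A b \<longleftrightarrow>
     w \<in> carrier_vec m \<and> (\<forall>i<m. 0 < w $ i) \<and>
     A \<in> carrier_mat m m \<and> b \<in> carrier_vec m \<and>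
     (\<forall>y \<in> carrier_vec m. mass w (A *\<^sub>v y) = 0) \<and>
     invertible_mat (gs_matrix \<alpha> A)"

end

theory Submission
  imports Defs
begin

text \<open>
  Let \<open>M = I - \<alpha>(D + L)\<close> and let \<open>u'\<close> be the successor of the iterate \<open>u\<close>. Multiplying the update by
  \<open>M\<close> removes the inverse and gives \<open>M u' = \<alpha> U u + b\<close>. Because \<open>M = I - \<alpha>(A - U)\<close>, this is
  \<open>u' = b + \<alpha> A u' - \<alpha> U(u' - u)\<close> (lemma \<open>gauss_seidel_Suc_component\<close>): an implicit step for the
  full matrix \<open>A\<close>, except for a defect that arises since \<open>U\<close> acts on the old iterate. Every vector
  \<open>A y\<close> has mass zero, so taking masses leaves only the mass of the defect, and that is the
  claimed conservation error (lemma \<open>gauss_seidel_conservation_error\<close>).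

  The defect vanishes if \<open>U = 0\<close>, which is the lower triangular case. In general it does not:
  let two cells of unit volume exchange mass through a matrix whose only off-diagonal entry is
  above the diagonal. The first component of \<open>u'\<close> then uses an outdated value of the second one,
  while the second component is updated implicitly, so what leaves one cell does not arrive in the
  other.
\<close>

section \<open>The Gauss--Seidel step without the inverse\<close>

lemma the_mat_inverse:
  fixes M :: "'a :: field mat"
  assumes M: "M \<in> carrier_mat n n" and inv: "invertible_mat M"
  shows "the (mat_inverse M) \<in> carrier_mat n n" "M * the (mat_inverse M) = 1\<^sub>m n"
proof -
  obtain B where MB: "M * B = 1\<^sub>m n" and BM: "B * M = 1\<^sub>m (dim_row B)"
    using inv M unfolding invertible_mat_def inverts_mat_def by auto
  have "dim_col B = n" using arg_cong[OF MB, of dim_col] by simp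
  moreover have "dim_row B = n" using arg_cong[OF BM, of dim_col] M by simp
  ultimately have "B \<in> carrier_mat n n" by auto
  with MB BM M have "M \<in> Units (ring_mat TYPE('a) n ())"
    unfolding Units_def ring_mat_def by auto
  then obtain C where C: "mat_inverse M = Some C"
    using mat_inverse(1)[OF M, of "()"] by (cases "mat_inverse M") auto
  show "the (mat_inverse M) \<in> carrier_mat n n" "M * the (mat_inverse M) = 1\<^sub>m n"
    using mat_inverse(2)[OF M C] C by auto
qed

lemma strict_upper_part_carrier:
  "A \<in> carrier_mat m n \<Longrightarrow> strict_upper_part A \<in> carrier_mat m n"
  unfolding strict_upper_part_def by auto

lemma gs_matrix_carrier: "A \<in> carrier_mat m m \<Longrightarrow> gs_matrix \<alpha> A \<in> carrier_mat m m"
  unfolding gs_matrix_def strict_lower_part_def by auto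

lemma gs_matrix_conv_strict_upper_part:
  assumes "A \<in> carrier_mat m m"
  shows "gs_matrix \<alpha> A = 1\<^sub>m m - \<alpha> \<cdot>\<^sub>m (A - strict_upper_part A)"
  by (rule eq_matI)
     (use assms in \<open>auto simp: gs_matrix_def diag_part_def strict_lower_part_def
        strict_upper_part_def\<close>)

lemma smult_mat_mult_vec:
  fixes A :: "'a :: comm_ring_1 mat"
  assumes "A \<in> carrier_mat m n" "x \<in> carrier_vec n"
  shows "(c \<cdot>\<^sub>m A) *\<^sub>v x = c \<cdot>\<^sub>v (A *\<^sub>v x)"
  by (rule eq_vecI) (use assms in \<open>auto simp: scalar_prod_def sum_distrib_left mult.assoc\<close>)

lemma strict_upper_part_mult_vec:
  assumes A: "A \<in> carrier_mat m n" and x: "x \<in> carrier_vec n" and i: "i < m"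
  shows "(strict_upper_part A *\<^sub>v x) $ i = (\<Sum>j\<in>{Suc i..<n}. A $$ (i, j) * x $ j)"
proof -
  have "(strict_upper_part A *\<^sub>v x) $ i
      = (\<Sum>j\<in>{0..<n}. if i < j then A $$ (i, j) * x $ j else 0)"
    using assms by (auto simp: strict_upper_part_def scalar_prod_def intro!: sum.cong)
  also have "\<dots> = (\<Sum>j\<in>{Suc i..<n}. A $$ (i, j) * x $ j)"
    by (rule sum.mono_neutral_cong_right) auto
  finally show ?thesis .
qed

lemma gauss_seidel_carrier:
  assumes A: "A \<in> carrier_mat m m" and inv: "invertible_mat (gs_matrix \<alpha> A)"
    and u0: "u0 \<in> carrier_vec m"
  shows "gauss_seidel \<alpha> A b u0 k \<in> carrier_vec m"
proof (cases k)
  case (Suc l)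
  have "dim_row (the (mat_inverse (gs_matrix \<alpha> A))) = m"
    using the_mat_inverse(1)[OF gs_matrix_carrier[OF A] inv] by simp
  then show ?thesis using Suc by (intro carrier_vecI) simp
qed (simp add: u0)

lemma gauss_seidel_Suc_implicit:
  assumes A: "A \<in> carrier_mat m m" and b: "b \<in> carrier_vec m"
    and inv: "invertible_mat (gs_matrix \<alpha> A)" and u0: "u0 \<in> carrier_vec m"
  shows "gs_matrix \<alpha> A *\<^sub>v gauss_seidel \<alpha> A b u0 (Suc k)
       = \<alpha> \<cdot>\<^sub>v (strict_upper_part A *\<^sub>v gauss_seidel \<alpha> A b u0 k) + b"
proof -
  define M where "M = gs_matrix \<alpha> A"
  define B where "B = the (mat_inverse M)"
  define U where "U = strict_upper_part A"
  define u where "u = gauss_seidel \<alpha> A b u0 k"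
  have M: "M \<in> carrier_mat m m" unfolding M_def by (rule gs_matrix_carrier[OF A])
  have B: "B \<in> carrier_mat m m" and MB: "M * B = 1\<^sub>m m"
    using the_mat_inverse[OF M] inv unfolding B_def M_def by auto
  have U: "U \<in> carrier_mat m m" unfolding U_def by (rule strict_upper_part_carrier[OF A])
  have u: "u \<in> carrier_vec m" unfolding u_def by (rule gauss_seidel_carrier[OF A inv u0])
  have Uu: "\<alpha> \<cdot>\<^sub>v (U *\<^sub>v u) \<in> carrier_vec m" using U u by auto
  have "(\<alpha> \<cdot>\<^sub>m (B * U)) *\<^sub>v u = B *\<^sub>v (\<alpha> \<cdot>\<^sub>v (U *\<^sub>v u))"
    using B U u by (simp add: smult_mat_mult_vec[of _ m m] mult_mat_vec[of _ m m])
  then have "gauss_seidel \<alpha> A b u0 (Suc k) = B *\<^sub>v (\<alpha> \<cdot>\<^sub>v (U *\<^sub>v u) + b)"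
    using mult_add_distrib_mat_vec[OF B Uu b] by (simp add: B_def M_def U_def u_def)
  then have "M *\<^sub>v gauss_seidel \<alpha> A b u0 (Suc k) = (M * B) *\<^sub>v (\<alpha> \<cdot>\<^sub>v (U *\<^sub>v u) + b)"
    using M B Uu b by simp
  also have "\<dots> = \<alpha> \<cdot>\<^sub>v (U *\<^sub>v u) + b"
    unfolding MB using Uu b by simp
  finally show ?thesis unfolding M_def U_def u_def .
qed

text \<open>Substituting \<open>D + L = A - U\<close> makes the full matrix act on the new iterate, which is what the
  zero mass condition on \<open>A\<close> can be applied to; what \<open>U\<close> does to the increment is left over.\<close>

lemma gauss_seidel_Suc_component:
  fixes k :: nat
  assumes A: "A \<in> carrier_mat m m" and b: "b \<in> carrier_vec m"
    and inv: "invertible_mat (gs_matrix \<alpha> A)" and u0: "u0 \<in> carrier_vec m" and i: "i < m"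
  defines "u \<equiv> gauss_seidel \<alpha> A b u0 k" and "u' \<equiv> gauss_seidel \<alpha> A b u0 (Suc k)"
  shows "u' $ i = b $ i + \<alpha> * (A *\<^sub>v u') $ i
           - \<alpha> * (\<Sum>j\<in>{Suc i..<m}. A $$ (i, j) * (u' $ j - u $ j))"
proof -
  define U where "U = strict_upper_part A"
  have U: "U \<in> carrier_mat m m" unfolding U_def by (rule strict_upper_part_carrier[OF A])
  have u: "u \<in> carrier_vec m" and u': "u' \<in> carrier_vec m"
    unfolding u_def u'_def by (rule gauss_seidel_carrier[OF A inv u0])+
  have AU: "A - U \<in> carrier_mat m m" using A U by auto
  have "gs_matrix \<alpha> A *\<^sub>v u' = u' - \<alpha> \<cdot>\<^sub>v (A *\<^sub>v u' - U *\<^sub>v u')"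
    using minus_mult_distrib_mat_vec[OF one_carrier_mat smult_carrier_mat[OF AU] u']
      smult_mat_mult_vec[OF AU u'] minus_mult_distrib_mat_vec[OF A U u'] u'
    by (simp add: gs_matrix_conv_strict_upper_part[OF A] U_def)
  then have "u' - \<alpha> \<cdot>\<^sub>v (A *\<^sub>v u' - U *\<^sub>v u') = \<alpha> \<cdot>\<^sub>v (U *\<^sub>v u) + b"
    using gauss_seidel_Suc_implicit[OF A b inv u0] unfolding u_def u'_def U_def by simp
  from arg_cong[OF this, of "\<lambda>v. v $ i"]
  have "u' $ i - \<alpha> * ((A *\<^sub>v u') $ i - (U *\<^sub>v u') $ i) = \<alpha> * (U *\<^sub>v u) $ i + b $ i"
    using A U u u' b i by (simp del: index_mult_mat_vec)
  moreover have "(\<Sum>j\<in>{Suc i..<m}. A $$ (i, j) * (u' $ j - u $ j))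
      = (U *\<^sub>v u') $ i - (U *\<^sub>v u) $ i"
    unfolding U_def strict_upper_part_mult_vec[OF A u i] strict_upper_part_mult_vec[OF A u' i]
    by (simp add: sum_subtractf right_diff_distrib)
  ultimately show ?thesis by (simp add: right_diff_distrib del: index_mult_mat_vec)
qed

section \<open>The conservation error\<close>

lemma gauss_seidel_conservation_error:
  assumes gs: "gs_setting m w \<alpha> A b" and u0: "u0 \<in> carrier_vec m"
  shows "mass w (gauss_seidel \<alpha> A b u0 (Suc k)) - mass w b =
           - \<alpha> * (\<Sum>i<m. w $ i *
               (\<Sum>j\<in>{Suc i..<m}. A $$ (i, j) *
                  (gauss_seidel \<alpha> A b u0 (Suc k) $ j - gauss_seidel \<alpha> A b u0 k $ j)))"
proof -
  define u' where "u' = gauss_seidel \<alpha> A b u0 (Suc k)"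
  define d where "d i = (\<Sum>j\<in>{Suc i..<m}. A $$ (i, j) * (u' $ j - gauss_seidel \<alpha> A b u0 k $ j))"
    for i
  have A: "A \<in> carrier_mat m m" and b: "b \<in> carrier_vec m"
    and inv: "invertible_mat (gs_matrix \<alpha> A)"
    and zero: "\<And>y. y \<in> carrier_vec m \<Longrightarrow> mass w (A *\<^sub>v y) = 0"
    using gs unfolding gs_setting_def by auto
  have u': "u' \<in> carrier_vec m"
    unfolding u'_def by (rule gauss_seidel_carrier[OF A inv u0])
  have comp: "u' $ i = b $ i + \<alpha> * (A *\<^sub>v u') $ i - \<alpha> * d i" if "i < m" for i
    unfolding d_def u'_def by (rule gauss_seidel_Suc_component[OF A b inv u0 that])
  have "mass w u' = (\<Sum>i<m. w $ i * u' $ i)"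
    using u' by (simp add: mass_def)
  also have "\<dots> = (\<Sum>i<m. w $ i * (b $ i + \<alpha> * (A *\<^sub>v u') $ i - \<alpha> * d i))"
    by (rule sum.cong) (simp_all only: comp lessThan_iff)
  also have "\<dots> = (\<Sum>i<m. w $ i * b $ i) + \<alpha> * (\<Sum>i<m. w $ i * (A *\<^sub>v u') $ i)
      - \<alpha> * (\<Sum>i<m. w $ i * d i)"
    by (simp add: sum_distrib_left sum.distrib sum_subtractf algebra_simps
        del: index_mult_mat_vec)
  also have "\<dots> = mass w b + \<alpha> * mass w (A *\<^sub>v u') - \<alpha> * (\<Sum>i<m. w $ i * d i)"
    using A b by (simp add: mass_def)
  finally show ?thesis
    using zero[OF u'] unfolding d_def u'_def by simp
qed

lemma gauss_seidel_lower_triangular_conservative: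
  assumes gs: "gs_setting m w \<alpha> A b" and lower: "lower_triangular A"
    and u0: "u0 \<in> carrier_vec m"
  shows "mass w (gauss_seidel \<alpha> A b u0 (Suc k)) = mass w b"
proof -
  have "A $$ (i, j) = 0" if "j \<in> {Suc i..<m}" for i j
    using gs lower that unfolding gs_setting_def lower_triangular_def by auto
  then show ?thesis
    using gauss_seidel_conservation_error[OF gs u0, of k] by simp
qed

section \<open>A step that does not conserve mass\<close>

text \<open>The matrix moves mass from the second cell to the first one. For the right-hand side zero and
  the initial guess \<open>(1, -1)\<close>, the new second component is zero, since its row of the system contains
  no old values; the defect \<open>a\<^sub>0\<^sub>1 (u'\<^sub>1 - u\<^sub>1)\<close> is then \<open>1\<close>.\<close>

lemma gauss_seidel_not_conservative_example:
  defines "w \<equiv> vec 2 (\<lambda>_. 1)"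
    and "A \<equiv> mat 2 2 (\<lambda>(i, j). if j = 1 then (if i = 0 then 1 else - 1) else 0)"
    and "u0 \<equiv> vec 2 (\<lambda>i. if i = 0 then 1 else - 1)"
  shows "gs_setting 2 w 1 A (0\<^sub>v 2)" "u0 \<in> carrier_vec 2" "mass w u0 = mass w (0\<^sub>v 2)"
    "mass w (gauss_seidel 1 A (0\<^sub>v 2) u0 1) \<noteq> mass w (0\<^sub>v 2)"
proof -
  have sum2: "(\<Sum>i\<in>{0..<2}. f i) = f 0 + f 1" "(\<Sum>i<2. f i) = f 0 + f 1" for f :: "nat \<Rightarrow> real"
    by (simp_all add: numeral_2_eq_2)
  have A: "A \<in> carrier_mat 2 2" unfolding A_def by simp
  show u0: "u0 \<in> carrier_vec 2" unfolding u0_def by simp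
  have zero: "mass w (A *\<^sub>v y) = 0" if "y \<in> carrier_vec 2" for y
    using that by (simp add: mass_def w_def A_def scalar_prod_def sum2)
  have inv: "invertible_mat (gs_matrix 1 A)"
  proof -
    define B :: "real mat"
      where "B = mat 2 2 (\<lambda>(i, j). if i = j then (if i = 0 then 1 else 1 / 2) else 0)"
    have M: "gs_matrix 1 A = mat 2 2 (\<lambda>(i, j). if i = j then (if i = 0 then 1 else 2) else 0)"
      by (rule eq_matI)
         (auto simp: gs_matrix_def A_def diag_part_def strict_lower_part_def less_2_cases_iff)
    have "gs_matrix 1 A * B = 1\<^sub>m 2" "B * gs_matrix 1 A = 1\<^sub>m 2"
      unfolding M B_def
      by (rule eq_matI; auto simp: scalar_prod_def sum2 less_2_cases_iff)+
    then show ?thesis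
      unfolding invertible_mat_def inverts_mat_def M by (auto simp: B_def)
  qed
  show gs: "gs_setting 2 w 1 A (0\<^sub>v 2)"
    unfolding gs_setting_def using A zero inv by (auto simp: w_def)
  show "mass w u0 = mass w (0\<^sub>v 2)"
    by (simp add: mass_def w_def u0_def sum2)
  define u' where "u' = gauss_seidel 1 A (0\<^sub>v 2) u0 (Suc 0)"
  have u': "u' \<in> carrier_vec 2"
    unfolding u'_def by (rule gauss_seidel_carrier[OF A inv u0])
  \<comment> \<open>The second row of the system reads \<open>2 * u' $ 1 = 0\<close>.\<close>
  have "u' $ 1 = (A *\<^sub>v u') $ 1"
    using gauss_seidel_Suc_component[OF A zero_carrier_vec inv u0, of 1 0]
    unfolding u'_def by simp
  then have "u' $ 1 = 0"
    using u' by (simp add: A_def scalar_prod_def sum2)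
  moreover have "mass w u' - mass w (0\<^sub>v 2)
      = - (\<Sum>i<2. w $ i * (\<Sum>j\<in>{Suc i..<2}. A $$ (i, j) * (u' $ j - u0 $ j)))"
    using gauss_seidel_conservation_error[OF gs u0, of 0] unfolding u'_def by simp
  ultimately have "mass w u' - mass w (0\<^sub>v 2) = - 1"
    by (simp add: sum2 w_def A_def u0_def numeral_2_eq_2)
  then show "mass w (gauss_seidel 1 A (0\<^sub>v 2) u0 1) \<noteq> mass w (0\<^sub>v 2)"
    unfolding u'_def by simp
qed

theorem mainTheorem9:
  shows "(\<forall>m w \<alpha> A b. gs_setting m w \<alpha> A b \<longrightarrow>
            (\<forall>u0 \<in> carrier_vec m. \<forall>k.
               mass w (gauss_seidel \<alpha> A b u0 (Suc k)) - mass w b =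
                 - \<alpha> * (\<Sum>i<m. w $ i *
                     (\<Sum>j\<in>{Suc i..<m}. A $$ (i, j) *
                        (gauss_seidel \<alpha> A b u0 (Suc k) $ j - gauss_seidel \<alpha> A b u0 k $ j)))))
       \<and> (\<exists>m w \<alpha> A b. gs_setting m w \<alpha> A b \<and>
            \<not> globally_conservative w b (gauss_seidel \<alpha> A b) \<and>
            (\<exists>u0 \<in> carrier_vec m. mass w u0 = mass w b \<and>
               mass w (gauss_seidel \<alpha> A b u0 1) \<noteq> mass w b))
       \<and> (\<forall>m w \<alpha> A b. gs_setting m w \<alpha> A b \<and> lower_triangular A \<longrightarrow>
            (\<forall>u0 \<in> carrier_vec m. \<forall>k.
               mass w (gauss_seidel \<alpha> A b u0 (Suc k)) = mass w b))"
proof (intro conjI)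
  show "\<exists>m w \<alpha> A b. gs_setting m w \<alpha> A b \<and>
          \<not> globally_conservative w b (gauss_seidel \<alpha> A b) \<and>
          (\<exists>u0 \<in> carrier_vec m. mass w u0 = mass w b \<and>
             mass w (gauss_seidel \<alpha> A b u0 1) \<noteq> mass w b)"
  proof -
    obtain w A u0 where ex: "gs_setting 2 w 1 A (0\<^sub>v 2)" "u0 \<in> carrier_vec 2"
      "mass w u0 = mass w (0\<^sub>v 2)" "mass w (gauss_seidel 1 A (0\<^sub>v 2) u0 1) \<noteq> mass w (0\<^sub>v 2)"
      using gauss_seidel_not_conservative_example by blast
    moreover from ex have "\<not> globally_conservative w (0\<^sub>v 2) (gauss_seidel 1 A (0\<^sub>v 2))"
      unfolding globally_conservative_def One_nat_def by (metis index_zero_vec(2))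
    ultimately show ?thesis by blast
  qed
qed (use gauss_seidel_conservation_error gauss_seidel_lower_triangular_conservative in blast)+

end
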